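(* Let $M$ be a Puiseux monoid. The following conditions are equivalent: (1) $M$ contains a minimal set of generators; (2) $M$ contains a unique minimal set of generators; (3) $M$ is atomic.
   Context: A Puiseux monoid is an additive submonoid of $\mathbb{Q}_{\ge 0}$ (it contains $0$). For $S\subseteq M$, $\langle S\rangle$ denotes the submonoid generated by $S$, and $S$ is a set of generators of $M$ if $M=\langle S\rangle$. A set of generators $S$ of $M$ is minimal if no proper subset of $S$ generates $M$. Since the only unit of a Puiseux monoid is $0$, an atom of $M$ is a nonzero $a\in M$ such that $a=x+y$ with $x,y\in M$ implies $x=0$ or $y=0$; $\mathcal{A}(M)$ is the set of atoms of $M$. $M$ is atomic if every nonzero element of $M$ is a finite sum of atoms, i.e. $M=\langle \mathcal{A}(M)\rangle$. *)

theory Defs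
  imports Complex_Main
begin

definition add_submonoid :: "rat set \<Rightarrow> bool" where
  "add_submonoid M \<longleftrightarrow> 0 \<in> M \<and> (\<forall>x\<in>M. \<forall>y\<in>M. x + y \<in> M)"

definition puiseux_monoid :: "rat set \<Rightarrow> bool" where
  "puiseux_monoid M \<longleftrightarrow> add_submonoid M \<and> M \<subseteq> {0..}"

definition generated_submonoid :: "rat set \<Rightarrow> rat set" where
  "generated_submonoid S = add_submonoid hull S"

definition set_of_generators :: "rat set \<Rightarrow> rat set \<Rightarrow> bool" where
  "set_of_generators M S \<longleftrightarrow> S \<subseteq> M \<and> M = generated_submonoid S"

definition minimal_set_of_generators :: "rat set \<Rightarrow> rat set \<Rightarrow> bool" where
  "minimal_set_of_generators M S \<longleftrightarrow>
     set_of_generators M S \<and> (\<forall>T. T \<subset> S \<longrightarrow> \<not> set_of_generators M T)"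

text \<open>Stated with \<open>0\<close> in place of arbitrary units: \<open>0\<close> is the only unit of a Puiseux monoid.\<close>

definition atoms :: "rat set \<Rightarrow> rat set" where
  "atoms M = {a \<in> M. a \<noteq> 0 \<and> (\<forall>x\<in>M. \<forall>y\<in>M. a = x + y \<longrightarrow> x = 0 \<or> y = 0)}"

definition atomic :: "rat set \<Rightarrow> bool" where
  "atomic M \<longleftrightarrow> (\<forall>x\<in>M. x \<noteq> 0 \<longrightarrow> (\<exists>as. set as \<subseteq> atoms M \<and> x = sum_list as))"

lemma generated_submonoid_eq_sum_lists:
  "generated_submonoid S = {sum_list xs | xs. set xs \<subseteq> S}"
  unfolding generated_submonoid_def
proof (rule hull_unique)
  show "S \<subseteq> {sum_list xs | xs. set xs \<subseteq> S}"
  proof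
    fix x assume "x \<in> S"
    then have "set [x] \<subseteq> S" "x = sum_list [x]" by simp_all
    then show "x \<in> {sum_list xs | xs. set xs \<subseteq> S}" by blast
  qed
  have "0 \<in> {sum_list xs | xs. set xs \<subseteq> S}"
    by (auto intro!: exI[of _ "[]"])
  moreover have "x + y \<in> {sum_list xs | xs. set xs \<subseteq> S}"
    if "x \<in> {sum_list xs | xs. set xs \<subseteq> S}" "y \<in> {sum_list xs | xs. set xs \<subseteq> S}" for x y
  proof -
    from that obtain xs ys where "set xs \<subseteq> S" "x = sum_list xs" "set ys \<subseteq> S" "y = sum_list ys"
      by blast
    then have "set (xs @ ys) \<subseteq> S" "x + y = sum_list (xs @ ys)" by simp_all
    then show ?thesis by blast
  qed
  ultimately show "add_submonoid {sum_list xs | xs. set xs \<subseteq> S}"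
    unfolding add_submonoid_def by blast
  fix T assume T: "S \<subseteq> T" "add_submonoid T"
  have "sum_list xs \<in> T" if "set xs \<subseteq> S" for xs
    using that T by (induction xs) (auto simp: add_submonoid_def)
  then show "{sum_list xs | xs. set xs \<subseteq> S} \<subseteq> T" by blast
qed

lemma atomic_iff_generated_by_atoms:
  assumes "puiseux_monoid M"
  shows "atomic M \<longleftrightarrow> M = generated_submonoid (atoms M)"
proof -
  have M: "0 \<in> M" "add_submonoid M"
    using assms by (auto simp: puiseux_monoid_def add_submonoid_def)
  have "generated_submonoid (atoms M) \<subseteq> M"
    unfolding generated_submonoid_def
    by (rule hull_minimal) (use M in \<open>auto simp: atoms_def\<close>)
  moreover have "0 \<in> generated_submonoid (atoms M)"
    by (auto simp: generated_submonoid_eq_sum_lists intro!: exI[of _ "[]"])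
  ultimately have "M = generated_submonoid (atoms M) \<longleftrightarrow>
      (\<forall>x\<in>M. x \<noteq> 0 \<longrightarrow> x \<in> generated_submonoid (atoms M))"
    by (metis subset_antisym subsetI)
  then show ?thesis
    unfolding atomic_def generated_submonoid_eq_sum_lists by blast
qed

end

theory Submission
  imports Defs
begin

text \<open>
  The atoms are the only possible minimal set of generators.  They lie in every set of generators,
  because a sum of elements of \<open>M\<close> that equals an atom has a single nonzero summand
  (\<open>atoms_subset_generators\<close>).  Conversely, a member \<open>s\<close> of a minimal set of generators \<open>S\<close> is an
  atom: if \<open>s = x + y\<close> with \<open>x\<close> and \<open>y\<close> both positive, then both are smaller than \<open>s\<close>, so their
  expressions by generators do not involve \<open>s\<close>, and \<open>S - {s}\<close> still generates \<open>M\<close>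
  (\<open>minimal_generators_subset_atoms\<close>).  Hence a minimal set of generators exists exactly when
  the atoms generate \<open>M\<close>, that is when \<open>M\<close> is atomic, and then it is the set of atoms.
\<close>

lemma sum_list_in_add_submonoid:
  "add_submonoid M \<Longrightarrow> set xs \<subseteq> M \<Longrightarrow> sum_list xs \<in> M"
  by (induction xs) (auto simp: add_submonoid_def)

lemma add_submonoid_generated_submonoid: "add_submonoid (generated_submonoid S)"
  unfolding generated_submonoid_def
  by (rule hull_in) (auto simp: add_submonoid_def)

text \<open>Peel off the summands one at a time: the head or the remaining sum vanishes, so the
  atom is either the head itself or the sum of a shorter list.\<close>

lemma atom_sum_list_mem:
  assumes "add_submonoid M" "set xs \<subseteq> M" "sum_list xs \<in> atoms M"
  shows "sum_list xs \<in> set xs"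
  using assms(2,3)
proof (induction xs)
  case Nil
  then show ?case by (simp add: atoms_def)
next
  case (Cons x xs)
  have "sum_list xs \<in> M"
    using Cons.prems(1) sum_list_in_add_submonoid[OF assms(1)] by simp
  then have "x = 0 \<or> sum_list xs = 0"
    using Cons.prems by (auto simp: atoms_def)
  then show ?case using Cons by auto
qed

lemma atoms_subset_generators:
  assumes "add_submonoid M" "set_of_generators M S"
  shows "atoms M \<subseteq> S"
proof
  fix a assume a: "a \<in> atoms M"
  then have "a \<in> generated_submonoid S"
    using assms(2) unfolding set_of_generators_def atoms_def by blast
  then obtain xs where xs: "set xs \<subseteq> S" "a = sum_list xs"
    by (auto simp: generated_submonoid_eq_sum_lists)
  have "S \<subseteq> M" using assms(2) unfolding set_of_generators_def by blast
  with xs a assms(1) show "a \<in> S" using atom_sum_list_mem by blast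
qed

text \<open>As all summands are nonnegative, none of them exceeds the sum, so an element below \<open>s\<close>
  cannot use \<open>s\<close>.\<close>

lemma less_in_generated_submonoid_remove:
  assumes "S \<subseteq> {0..}" "x \<in> generated_submonoid S" "x < s"
  shows "x \<in> generated_submonoid (S - {s})"
proof -
  obtain xs where xs: "set xs \<subseteq> S" "x = sum_list xs"
    using assms(2) by (auto simp: generated_submonoid_eq_sum_lists)
  have "z \<le> sum_list xs" if "z \<in> set xs" for z
    using xs(1) assms(1) that by (intro member_le_sum_list) auto
  then have "set xs \<subseteq> S - {s}" using xs assms(3) by fastforce
  with xs(2) show ?thesis by (auto simp: generated_submonoid_eq_sum_lists)
qed

lemma minimal_generators_irredundant:
  assumes "minimal_set_of_generators M S" "s \<in> S"
  shows "s \<notin> generated_submonoid (S - {s})"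
proof
  assume "s \<in> generated_submonoid (S - {s})"
  then have "generated_submonoid (insert s (S - {s})) = generated_submonoid (S - {s})"
    unfolding generated_submonoid_def by (rule hull_redundant)
  then have "set_of_generators M (S - {s})"
    using assms by (auto simp: minimal_set_of_generators_def set_of_generators_def insert_absorb)
  then show False using assms by (auto simp: minimal_set_of_generators_def)
qed

lemma minimal_generators_subset_atoms:
  assumes "puiseux_monoid M" "minimal_set_of_generators M S"
  shows "S \<subseteq> atoms M"
proof
  fix s assume s: "s \<in> S"
  let ?G = "generated_submonoid (S - {s})"
  have S: "S \<subseteq> M" "M = generated_submonoid S" and nonneg: "M \<subseteq> {0..}"
    using assms
    unfolding minimal_set_of_generators_def set_of_generators_def puiseux_monoid_def by blast+
  have s_notin: "s \<notin> ?G" using minimal_generators_irredundant[OF assms(2) s] .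
  have G: "0 \<in> ?G" "\<And>x y. x \<in> ?G \<Longrightarrow> y \<in> ?G \<Longrightarrow> x + y \<in> ?G"
    using add_submonoid_generated_submonoid by (auto simp: add_submonoid_def)
  have "x = 0 \<or> y = 0" if xy: "x \<in> M" "y \<in> M" "s = x + y" for x y
  proof (rule ccontr)
    assume "\<not> (x = 0 \<or> y = 0)"
    then have "x < s" "y < s" using xy nonneg by fastforce+
    then have "x \<in> ?G" "y \<in> ?G"
      using less_in_generated_submonoid_remove xy S nonneg by blast+
    then show False using G(2) xy(3) s_notin by blast
  qed
  moreover have "s \<noteq> 0" using G(1) s_notin by metis
  ultimately show "s \<in> atoms M" using s S(1) by (auto simp: atoms_def)
qed

lemma minimal_set_of_generators_iff:
  assumes "puiseux_monoid M"
  shows "minimal_set_of_generators M S \<longleftrightarrow> atomic M \<and> S = atoms M"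
proof -
  have M: "add_submonoid M" using assms by (simp add: puiseux_monoid_def)
  have atomic: "atomic M \<longleftrightarrow> set_of_generators M (atoms M)"
    using atomic_iff_generated_by_atoms[OF assms] by (auto simp: set_of_generators_def atoms_def)
  show ?thesis
  proof
    assume S: "minimal_set_of_generators M S"
    then have gen: "set_of_generators M S" by (simp add: minimal_set_of_generators_def)
    have "S = atoms M"
      using atoms_subset_generators[OF M gen] minimal_generators_subset_atoms[OF assms S] by blast
    with gen atomic show "atomic M \<and> S = atoms M" by simp
  next
    assume "atomic M \<and> S = atoms M"
    then show "minimal_set_of_generators M S"
      using atomic atoms_subset_generators[OF M] by (auto simp: minimal_set_of_generators_def)
  qed
qed

theorem theorem3p6:
  fixes M :: "rat set"
  assumes "puiseux_monoid M"
  shows "((\<exists>S. minimal_set_of_generators M S) \<longleftrightarrow> (\<exists>!S. minimal_set_of_generators M S))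
       \<and> ((\<exists>!S. minimal_set_of_generators M S) \<longleftrightarrow> atomic M)"
  using minimal_set_of_generators_iff[OF assms] by auto

end
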